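(* Let $R$ be a complete Hausdorff non-archimedean commutative ring and let $q\in R$ be topologically nilpotent. Then $$(q;q)_\infty=\sum_{k\in\mathbb{Z}}(-1)^k q^{\frac{3k^2-k}{2}}.$$
   Context: A non-archimedean ring is a topological ring in which every neighborhood of $0$ contains an open additive subgroup. Completeness is with respect to the uniform structure of the additive group. An element $q$ is topologically nilpotent if $q^n\to 0$ as $n\to\infty$. The infinite $q$-Pochhammer symbol is $(a;q)_\infty:=\lim_{n\to\infty}\prod_{i=0}^{n-1}(1-aq^i)$. The sum over $\mathbb{Z}$ is the unconditional sum in $R$ (limit over finite subsets of $\mathbb{Z}$ ordered by inclusion). *)

theory Defs
  imports "HOL-Analysis.Analysis"
begin

text \<open>
  \<^class>\<open>comm_ring_1\<close> would add \<open>0 \<noteq> 1\<close>. A commutative unital ring is taken here as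
  \<^class>\<open>comm_ring\<close> together with \<^class>\<open>comm_monoid_mult\<close>, so that the zero ring is included.
\<close>

class topological_comm_ring =
  comm_ring + comm_monoid_mult + topological_ab_group_add + topological_comm_monoid_mult

definition (in group_add) additive_subgroup_set :: "'a set \<Rightarrow> bool" where
  "additive_subgroup_set H \<longleftrightarrow>
     0 \<in> H \<and> (\<forall>x\<in>H. \<forall>y\<in>H. x + y \<in> H) \<and> (\<forall>x\<in>H. - x \<in> H)"

class nonarchimedean_comm_ring = topological_comm_ring +
  assumes nonarchimedean:
    "eventually (\<lambda>x. x \<in> N) (nhds 0) \<Longrightarrow> \<exists>H. open H \<and> additive_subgroup_set H \<and> H \<subseteq> N"

text \<open>
  Completeness refers to the uniform structure of the additive group. In the library class
  \<^class>\<open>uniform_topological_group_add\<close> the uniformity is a class parameter, but the axioms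
  (compatibility with the topology, uniform continuity of addition and negation) force it to be
  the one induced by the neighbourhoods of 0:
\<close>

lemma uniformity_eq_additive_uniformity:
  "(uniformity :: ('a::uniform_topological_group_add \<times> 'a) filter) =
     filtercomap (\<lambda>(x, y). y - x) (nhds 0)"
proof (rule filter_eqI)
  fix P :: "'a \<times> 'a \<Rightarrow> bool"
  show "eventually P uniformity \<longleftrightarrow> eventually P (filtercomap (\<lambda>(x, y). y - x) (nhds 0))"
  proof
    assume "eventually P uniformity"
    then obtain Q where Q: "eventually Q uniformity" "\<And>a b c. Q (a, b) \<Longrightarrow> P (a + c, b + c)"
      using uniformity_of_uniform_continuous_invariant[OF uniformly_continuous_add'] by metis
    have "eventually (\<lambda>y. Q (0, y)) (nhds 0)"
      unfolding eventually_nhds_uniformity by (rule eventually_mono[OF Q(1)]) auto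
    moreover have "P (x, y)" if "Q (0, y - x)" for x y
      using Q(2)[OF that, of x] by simp
    ultimately show "eventually P (filtercomap (\<lambda>(x, y). y - x) (nhds 0))"
      unfolding eventually_filtercomap by (intro exI[of _ "\<lambda>y. Q (0, y)"]) auto
  next
    assume "eventually P (filtercomap (\<lambda>(x, y). y - x) (nhds 0))"
    then obtain U where U: "eventually U (nhds 0)" "\<And>x y. U (y - x) \<Longrightarrow> P (x, y)"
      unfolding eventually_filtercomap by auto
    have "eventually (\<lambda>(x, y). x = 0 \<longrightarrow> U y) uniformity"
      using U(1) by (simp add: eventually_nhds_uniformity)
    then obtain Q where Q: "eventually Q uniformity"
      "\<And>a b c. Q (a, b) \<Longrightarrow> (\<lambda>(x, y). x = 0 \<longrightarrow> U y) (a + c, b + c)"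
      using uniformity_of_uniform_continuous_invariant[OF uniformly_continuous_add'] by metis
    have "P (a, b)" if "Q (a, b)" for a b
      using Q(2)[OF that, of "- a"] U(2)[of b a] by simp
    then show "eventually P uniformity"
      by (intro eventually_mono[OF Q(1)]) auto
  qed
qed

definition topologically_nilpotent :: "'a::topological_comm_ring \<Rightarrow> bool" where
  "topologically_nilpotent q \<longleftrightarrow> (\<lambda>n. q ^ n) \<longlonglongrightarrow> 0"

definition q_pochhammer :: "'a::{comm_ring, comm_monoid_mult} \<Rightarrow> 'a \<Rightarrow> nat \<Rightarrow> 'a" where
  "q_pochhammer a q n = (\<Prod>i<n. 1 - a * q ^ i)"

definition q_pochhammer_inf :: "'a::{topological_comm_ring, t2_space} \<Rightarrow> 'a \<Rightarrow> 'a" where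
  "q_pochhammer_inf a q = lim (q_pochhammer a q)"

text \<open>
  The integer \<open>3 k\<^sup>2 - k\<close> is even and nonnegative for every \<open>k\<close>, so \<open>div\<close> and \<open>nat\<close> lose nothing
  in the exponent; \<open>\<bar>k\<bar>\<close> has the parity of \<open>k\<close>, so the sign is \<open>(-1)\<close> to the power \<open>k\<close>.
\<close>

definition pentagonal_term :: "'a::{comm_ring, comm_monoid_mult} \<Rightarrow> int \<Rightarrow> 'a" where
  "pentagonal_term q k = (- 1) ^ nat \<bar>k\<bar> * q ^ nat ((3 * k\<^sup>2 - k) div 2)"

end

theory Submission
  imports Defs
begin

text \<open>
  The identity follows from Shanks' finite form
  \[
    \sum_{k=-n}^{n} (-1)^k q^{(3k^2-k)/2}
      = \sum_{k=0}^{n} (-1)^k \frac{(q;q)_n}{(q;q)_k}\, q^{kn + k(k+1)/2}.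
  \]
  The quotients are the polynomials \<open>\<Prod>i\<in>{k<..n}. 1 - q ^ i\<close>, so no division is involved. The
  summand \<open>k = 0\<close> on the right is \<open>(q;q)\<^sub>n\<close>, and every other summand is an integer combination of
  powers of \<open>q\<close> with exponents at least \<open>n\<close>. An open subgroup contains all high powers of \<open>q\<close>,
  hence all those summands for large \<open>n\<close>; no boundedness of the coefficients is needed.
\<close>

section \<open>Shanks' finite form of the identity\<close>

definition shanks_term :: "'a::{comm_ring, comm_monoid_mult} \<Rightarrow> nat \<Rightarrow> nat \<Rightarrow> 'a" where
  "shanks_term q n k = (- 1) ^ k * (\<Prod>i\<in>{k<..n}. 1 - q ^ i) * q ^ (k * n + triangle k)"

lemma q_pochhammer_self_eq_prod: "q_pochhammer q q n = (\<Prod>i\<in>{0<..n}. 1 - q ^ i)"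
proof (induction n)
  case 0
  then show ?case by (simp add: q_pochhammer_def)
next
  case (Suc n)
  have "{0<..Suc n} = insert (Suc n) {0<..n}" by auto
  with Suc show ?case by (simp add: q_pochhammer_def mult.commute)
qed

lemma double_triangle: "2 * triangle n = n * Suc n"
  by (induction n) auto

text \<open>With k = n + 1, the exponent splits as (3k^2 - k)/2 = k^2 + k(k - 1)/2, and the last
  summand is \<open>triangle n\<close>; indexing by \<open>Suc n\<close> avoids subtraction on
  naturals. At -k the same split gives k^2 + k(k + 1)/2.\<close>

lemma pentagonal_term_of_nat_Suc:
  "pentagonal_term q (int (Suc n)) = (- 1) ^ Suc n * q ^ (Suc n * Suc n + triangle n)"
proof -
  have "3 * (int (Suc n))\<^sup>2 - int (Suc n) = 2 * int (Suc n * Suc n + triangle n)"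
    using arg_cong[OF double_triangle[of n], of int]
    by (simp add: power2_eq_square algebra_simps)
  then have "nat ((3 * (int (Suc n))\<^sup>2 - int (Suc n)) div 2) = Suc n * Suc n + triangle n"
    by (simp only: nonzero_mult_div_cancel_left nat_int)
  then show ?thesis
    unfolding pentagonal_term_def by (metis abs_of_nat nat_int)
qed

lemma pentagonal_term_uminus_of_nat:
  "pentagonal_term q (- int n) = (- 1) ^ n * q ^ (n * n + triangle n)"
proof -
  have "3 * (- int n)\<^sup>2 - (- int n) = 2 * int (n * n + triangle n)"
    using arg_cong[OF double_triangle[of n], of int]
    by (simp add: power2_eq_square algebra_simps)
  then have "nat ((3 * (- int n)\<^sup>2 - (- int n)) div 2) = n * n + triangle n"
    by (simp only: nonzero_mult_div_cancel_left nat_int)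
  then show ?thesis
    unfolding pentagonal_term_def by (metis abs_minus_cancel abs_of_nat nat_int)
qed

text \<open>Passing from \<open>n\<close> to \<open>Suc n\<close> changes every summand, but the
  changes telescope and leave one correction term. Stopping at \<open>m\<close> makes this provable
  by induction; the case \<open>m = n\<close>, with an empty product, is the one applied
  afterwards.\<close>

lemma sum_shanks_term_Suc_upto:
  fixes q :: "'a::{comm_ring, comm_monoid_mult}"
  assumes "m \<le> n"
  shows "(\<Sum>k\<le>m. shanks_term q (Suc n) k) = (\<Sum>k\<le>m. shanks_term q n k) -
           (- 1) ^ m * (\<Prod>i\<in>{m<..n}. 1 - q ^ i) * q ^ (Suc m * Suc n + triangle m)"
  using assms
proof (induction m)
  case 0
  have "{0<..Suc n} = insert (Suc n) {0<..n}" by auto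
  then show ?case by (simp add: shanks_term_def algebra_simps)
next
  case (Suc m)
  \<comment> \<open>The factor \<open>1 - y\<close> extends the product \<open>A\<close> by the top
    index \<open>Suc n\<close>, and \<open>1 - x\<close> extends it by the bottom index
    \<open>Suc m\<close>; \<open>z\<close> is the power of \<open>q\<close> in the summand
    \<open>Suc m\<close> at \<open>n\<close>.\<close>
  define s :: 'a where "s = (- 1) ^ m"
  define A where "A = (\<Prod>i\<in>{Suc m<..n}. 1 - q ^ i)"
  define x where "x = q ^ Suc m"
  define y where "y = q ^ Suc n"
  define z where "z = q ^ (Suc m * n + triangle (Suc m))"
  have top: "(\<Prod>i\<in>{Suc m<..Suc n}. 1 - q ^ i) = (1 - y) * A"
  proof -
    have "{Suc m<..Suc n} = insert (Suc n) {Suc m<..n}" using Suc.prems by auto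
    then show ?thesis by (simp add: A_def y_def)
  qed
  have bot: "(\<Prod>i\<in>{m<..n}. 1 - q ^ i) = (1 - x) * A"
  proof -
    have "{m<..n} = insert (Suc m) {Suc m<..n}" using Suc.prems by auto
    then show ?thesis by (simp add: A_def x_def)
  qed
  have e1: "q ^ (Suc m * Suc n + triangle (Suc m)) = x * z"
    unfolding x_def z_def power_add[symmetric] by (rule arg_cong[of _ _ "power q"]) simp
  have e2: "q ^ (Suc m * Suc n + triangle m) = z"
    unfolding z_def by (rule arg_cong[of _ _ "power q"]) simp
  have e3: "q ^ (Suc (Suc m) * Suc n + triangle (Suc m)) = x * y * z"
    unfolding x_def y_def z_def power_add[symmetric] by (rule arg_cong[of _ _ "power q"]) simp
  have "(\<Sum>k\<le>Suc m. shanks_term q (Suc n) k) =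
      (\<Sum>k\<le>m. shanks_term q n k) - s * ((1 - x) * A) * z - s * ((1 - y) * A) * (x * z)"
    using Suc by (simp add: shanks_term_def top bot e1 e2 s_def[symmetric]
        del: triangle_Suc mult_Suc mult_Suc_right)
  \<comment> \<open>The two products \<open>s * A * x * z\<close> cancel. What remains is the
    summand \<open>Suc m\<close> at \<open>n\<close> and the next correction term.\<close>
  also have "\<dots> = (\<Sum>k\<le>m. shanks_term q n k) - s * A * z + s * A * (x * y * z)"
    by (simp add: algebra_simps)
  also have "\<dots> = (\<Sum>k\<le>Suc m. shanks_term q n k) + s * A * (x * y * z)"
    by (simp add: shanks_term_def A_def[symmetric] z_def[symmetric] s_def[symmetric]
        del: triangle_Suc mult_Suc mult_Suc_right)
  finally show ?case
    by (simp add: e3 A_def[symmetric] s_def[symmetric]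
        del: triangle_Suc mult_Suc mult_Suc_right sum.atMost_Suc)
qed

theorem shanks_identity:
  "(\<Sum>k\<in>{- int n..int n}. pentagonal_term q k) = (\<Sum>k\<le>n. shanks_term q n k)"
proof (induction n)
  case 0
  then show ?case by (simp add: pentagonal_term_def shanks_term_def)
next
  case (Suc n)
  have "{- int (Suc n)..int (Suc n)} =
      insert (int (Suc n)) (insert (- int (Suc n)) {- int n..int n})" by auto
  then have "(\<Sum>k\<in>{- int (Suc n)..int (Suc n)}. pentagonal_term q k) =
      pentagonal_term q (int (Suc n)) + (pentagonal_term q (- int (Suc n)) +
      (\<Sum>k\<in>{- int n..int n}. pentagonal_term q k))"
    by simp
  \<comment> \<open>At \<open>m = n\<close> the correction, with its minus sign, is the pentagonal
    term at n + 1; the new summand \<open>k = Suc n\<close> is the one at -(n + 1).\<close>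
  also have "\<dots> = (\<Sum>k\<le>Suc n. shanks_term q (Suc n) k)"
    unfolding Suc pentagonal_term_of_nat_Suc pentagonal_term_uminus_of_nat sum.atMost_Suc
      sum_shanks_term_Suc_upto[OF order.refl]
    by (simp add: shanks_term_def del: triangle_Suc mult_Suc mult_Suc_right)
  finally show ?case .
qed

section \<open>Additive subgroups containing all high powers of q\<close>

lemma additive_subgroup_set_diff:
  "additive_subgroup_set H \<Longrightarrow> x \<in> H \<Longrightarrow> y \<in> H \<Longrightarrow> x - y \<in> H"
  unfolding additive_subgroup_set_def diff_conv_add_uminus by blast

lemma additive_subgroup_set_sum:
  fixes f :: "'b \<Rightarrow> 'a::ab_group_add"
  assumes "additive_subgroup_set H" "\<And>x. x \<in> A \<Longrightarrow> f x \<in> H"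
  shows "sum f A \<in> H"
  using assms(2)
  by (induction A rule: infinite_finite_induct)
     (use assms(1) in \<open>auto simp: additive_subgroup_set_def\<close>)

lemma additive_subgroup_set_sign_mult:
  fixes x :: "'a::{comm_ring, comm_monoid_mult}"
  assumes "additive_subgroup_set H" "x \<in> H"
  shows "(- 1) ^ k * x \<in> H"
  by (induction k) (use assms in \<open>auto simp: additive_subgroup_set_def mult.assoc\<close>)

text \<open>\<open>H\<close> need not be an ideal, so the product cannot simply be absorbed.
  Expanding one factor \<open>1 - q ^ i\<close> gives a difference of two expressions of the same
  shape with exponents \<open>m\<close> and \<open>m + i\<close>, which is why \<open>m\<close> is
  generalized in the induction.\<close>

lemma additive_subgroup_set_prod_mult_power:
  fixes q :: "'a::{comm_ring, comm_monoid_mult}"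
  assumes "additive_subgroup_set H" "\<And>m. N \<le> m \<Longrightarrow> q ^ m \<in> H" "N \<le> m"
  shows "(\<Prod>i\<in>I. 1 - q ^ i) * q ^ m \<in> H"
  using assms(3)
proof (induction I arbitrary: m rule: infinite_finite_induct)
  case (insert i I)
  have "(\<Prod>i\<in>insert i I. 1 - q ^ i) * q ^ m =
      (\<Prod>i\<in>I. 1 - q ^ i) * q ^ m - (\<Prod>i\<in>I. 1 - q ^ i) * q ^ (m + i)"
    using insert.hyps by (simp add: algebra_simps power_add)
  then show ?case
    using insert by (simp add: additive_subgroup_set_diff[OF assms(1)])
qed (use assms(2) in auto)

text \<open>The exponent is at least \<bar>k\<bar>, because k^2 dominates \<bar>k\<bar> on the
  integers.\<close>

lemma pentagonal_term_in_subgroup: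
  fixes q :: "'a::{comm_ring, comm_monoid_mult}"
  assumes "additive_subgroup_set H" "\<And>m. N \<le> m \<Longrightarrow> q ^ m \<in> H" "int N \<le> \<bar>k\<bar>"
  shows "pentagonal_term q k \<in> H"
proof -
  have "\<bar>k\<bar> \<le> k\<^sup>2"
    using self_le_power[of "\<bar>k\<bar>" 2] by (cases "k = 0") auto
  then have "2 * \<bar>k\<bar> \<le> 3 * k\<^sup>2 - k"
    by linarith
  then have "N \<le> nat ((3 * k\<^sup>2 - k) div 2)"
    using assms(3) by linarith
  then show ?thesis
    unfolding pentagonal_term_def by (intro additive_subgroup_set_sign_mult assms)
qed

text \<open>The same threshold \<open>N\<close> serves however many summands and factors occur,
  since \<open>H\<close> is closed under finite sums.\<close>

lemma shanks_remainder_in_subgroup: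
  fixes q :: "'a::{comm_ring, comm_monoid_mult}"
  assumes "additive_subgroup_set H" "\<And>m. N \<le> m \<Longrightarrow> q ^ m \<in> H" "N \<le> n"
  shows "(\<Sum>k\<in>{- int n..int n}. pentagonal_term q k) - q_pochhammer q q n \<in> H"
proof -
  have "shanks_term q n (Suc k) \<in> H" for k
    unfolding shanks_term_def mult.assoc
    by (intro additive_subgroup_set_sign_mult additive_subgroup_set_prod_mult_power[where N = N]
        assms) (use assms(3) in auto)
  moreover have "(\<Sum>k\<le>n. shanks_term q n k) =
      q_pochhammer q q n + (\<Sum>k<n. shanks_term q n (Suc k))"
    by (simp add: sum.atMost_shift shanks_term_def q_pochhammer_self_eq_prod)
  ultimately show ?thesis
    by (simp add: shanks_identity additive_subgroup_set_sum[OF assms(1)])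
qed

section \<open>Convergence and summation in non-archimedean rings\<close>

text \<open>Open subgroups form a neighborhood base at 0, so the membership lemmas above are enough
  to prove convergence.\<close>

lemma tendsto_zero_iff_open_subgroup:
  fixes f :: "'b \<Rightarrow> 'a::nonarchimedean_comm_ring"
  shows "(f \<longlongrightarrow> 0) F \<longleftrightarrow>
    (\<forall>H. open H \<longrightarrow> additive_subgroup_set H \<longrightarrow> (\<forall>\<^sub>F x in F. f x \<in> H))"
proof
  assume "(f \<longlongrightarrow> 0) F"
  then show "\<forall>H. open H \<longrightarrow> additive_subgroup_set H \<longrightarrow> (\<forall>\<^sub>F x in F. f x \<in> H)"
    unfolding tendsto_def additive_subgroup_set_def by blast
next
  assume *: "\<forall>H. open H \<longrightarrow> additive_subgroup_set H \<longrightarrow> (\<forall>\<^sub>F x in F. f x \<in> H)"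
  show "(f \<longlongrightarrow> 0) F"
  proof (rule topological_tendstoI)
    fix S :: "'a set" assume "open S" "0 \<in> S"
    then have "\<forall>\<^sub>F x in nhds 0. x \<in> S" by (simp add: eventually_nhds_in_open)
    then obtain H where "open H" "additive_subgroup_set H" "H \<subseteq> S"
      using nonarchimedean by blast
    with * show "\<forall>\<^sub>F x in F. f x \<in> S" by (blast intro: eventually_mono)
  qed
qed

text \<open>A family that tends to 0 along the cofinite sets is summable: once a finite sum includes
  all terms outside \<open>H\<close>, further terms move it only within a coset of \<open>H\<close>.
  The finite sums are thus Cauchy, and completeness applies.\<close>

lemma summable_on_nonarchimedean:
  fixes f :: "'b \<Rightarrow> 'a::{nonarchimedean_comm_ring, uniform_topological_group_add,
                   complete_uniform_space}"
  assumes "\<And>H. open H \<Longrightarrow> additive_subgroup_set H \<Longrightarrow> finite {x \<in> A. f x \<notin> H}"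
  shows "f summable_on A"
proof -
  have "cauchy_filter (filtermap (sum f) (finite_subsets_at_top A))"
    unfolding cauchy_filter_iff
  proof (intro allI impI)
    fix P :: "'a \<times> 'a \<Rightarrow> bool" assume "eventually P uniformity"
    then obtain U where U: "eventually U (nhds 0)" "\<And>x y. U (y - x) \<Longrightarrow> P (x, y)"
      unfolding uniformity_eq_additive_uniformity eventually_filtercomap by auto
    from U(1) have "\<forall>\<^sub>F x in nhds 0. x \<in> Collect U" by simp
    then obtain H where H: "open H" "additive_subgroup_set H" "H \<subseteq> Collect U"
      using nonarchimedean by blast
    define E where "E = {x \<in> A. f x \<notin> H}"
    have E: "finite E" "E \<subseteq> A" using assms[OF H(1,2)] by (auto simp: E_def)
    have *: "sum f X - sum f E \<in> H" if "finite X" "E \<subseteq> X" "X \<subseteq> A" for X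
    proof -
      have "sum f X - sum f E = sum f (X - E)"
        using sum_diff[OF that(1,2), of f] by simp
      also have "\<dots> \<in> H"
        using that by (intro additive_subgroup_set_sum[OF H(2)]) (auto simp: E_def)
      finally show ?thesis .
    qed
    \<comment> \<open>This is the coset of \<open>H\<close> through \<open>sum f E\<close>;
      differences of its elements lie in \<open>H\<close>, hence satisfy \<open>U\<close>.\<close>
    let ?X = "{x. x - sum f E \<in> H}"
    have "\<forall>\<^sub>F x in filtermap (sum f) (finite_subsets_at_top A). x \<in> ?X"
      unfolding eventually_filtermap eventually_finite_subsets_at_top using E * by auto
    moreover have "P (x, y)" if "x \<in> ?X" "y \<in> ?X" for x y
    proof -
      have "(y - sum f E) - (x - sum f E) \<in> H"
        using that additive_subgroup_set_diff[OF H(2)] by blast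
      then show ?thesis using H(3) U(2) by auto
    qed
    ultimately show "\<exists>X. (\<forall>\<^sub>F x in filtermap (sum f) (finite_subsets_at_top A). x \<in> X) \<and>
        (\<forall>z\<in>X \<times> X. P z)"
      by blast
  qed
  then have "convergent_filter (filtermap (sum f) (finite_subsets_at_top A))"
    by (rule cauchy_filter_convergent)
  then show ?thesis
    by (auto simp: convergent_filter_iff summable_on_def has_sum_def filterlim_def)
qed

section \<open>Passage to the limit\<close>

text \<open>This turns the unconditional sum into a limit of the symmetric partial sums of the
  finite identity.\<close>

lemma filterlim_symmetric_int_intervals:
  "filterlim (\<lambda>n. {- int n..int n}) (finite_subsets_at_top UNIV) sequentially"
proof -
  have "\<forall>\<^sub>F n in sequentially. X \<subseteq> {- int n..int n}" if "finite X" for X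
  proof (rule eventually_sequentiallyI)
    \<comment> \<open>The sum of absolute values bounds every element of \<open>X\<close> and also
      covers the empty set, where a maximum would be unspecified.\<close>
    fix n assume n: "nat (\<Sum>x\<in>X. \<bar>x\<bar>) \<le> n"
    show "X \<subseteq> {- int n..int n}"
    proof
      fix x assume "x \<in> X"
      then have "\<bar>x\<bar> \<le> (\<Sum>x\<in>X. \<bar>x\<bar>)"
        using that by (intro member_le_sum) auto
      with n show "x \<in> {- int n..int n}" by auto
    qed
  qed
  then show ?thesis
    unfolding filterlim_iff eventually_finite_subsets_at_top
    by (smt (verit, best) eventually_mono finite_atLeastAtMost_int subset_UNIV)
qed

text \<open>\<open>lim\<close> and the infinite sum are total functions, so convergence and
  summability are asserted alongside the equation to give it its intended meaning.\<close>

theorem theorem6p1p1: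
  fixes q :: "'a::{nonarchimedean_comm_ring, uniform_topological_group_add,
                   complete_uniform_space, t2_space}"
  assumes "topologically_nilpotent q"
  shows "convergent (q_pochhammer q q) \<and>
         pentagonal_term q summable_on (UNIV :: int set) \<and>
         q_pochhammer_inf q q = (\<Sum>\<^sub>\<infinity>k\<in>UNIV. pentagonal_term q k)"
proof -
  have powers: "\<exists>N. \<forall>m\<ge>N. q ^ m \<in> H" if "open H" "additive_subgroup_set H" for H
    using assms that
    unfolding topologically_nilpotent_def tendsto_zero_iff_open_subgroup eventually_sequentially
    by blast
  have summable: "pentagonal_term q summable_on UNIV"
  proof (rule summable_on_nonarchimedean)
    fix H :: "'a set" assume H: "open H" "additive_subgroup_set H"
    then obtain N where N: "\<And>m. N \<le> m \<Longrightarrow> q ^ m \<in> H" using powers by blast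
    have "{k \<in> UNIV. pentagonal_term q k \<notin> H} \<subseteq> {- int N..int N}"
      using pentagonal_term_in_subgroup[of H N q, OF H(2) N] by force
    then show "finite {k \<in> UNIV. pentagonal_term q k \<notin> H}"
      by (rule finite_subset) simp
  qed
  define L where "L = (\<Sum>\<^sub>\<infinity>k\<in>UNIV. pentagonal_term q k)"
  have "(sum (pentagonal_term q) \<longlongrightarrow> L) (finite_subsets_at_top UNIV)"
    using has_sum_infsum[OF summable] by (simp add: has_sum_def L_def)
  then have sums: "(\<lambda>n. \<Sum>k\<in>{- int n..int n}. pentagonal_term q k) \<longlonglongrightarrow> L"
    by (rule filterlim_compose[OF _ filterlim_symmetric_int_intervals])
  have "(\<lambda>n. (\<Sum>k\<in>{- int n..int n}. pentagonal_term q k) - q_pochhammer q q n) \<longlonglongrightarrow> 0"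
    unfolding tendsto_zero_iff_open_subgroup
  proof (intro allI impI)
    fix H :: "'a set" assume H: "open H" "additive_subgroup_set H"
    then obtain N where N: "\<And>m. N \<le> m \<Longrightarrow> q ^ m \<in> H" using powers by blast
    show "\<forall>\<^sub>F n in sequentially.
        (\<Sum>k\<in>{- int n..int n}. pentagonal_term q k) - q_pochhammer q q n \<in> H"
      by (rule eventually_sequentiallyI[of N], rule shanks_remainder_in_subgroup[OF H(2) N])
  qed
  \<comment> \<open>Convergence of the Pochhammer products is inherited here from that of the
    symmetric sums.\<close>
  from tendsto_diff[OF sums this] have "q_pochhammer q q \<longlonglongrightarrow> L"
    by simp
  then show ?thesis
    using summable by (auto simp: q_pochhammer_inf_def L_def[symmetric] convergent_def intro: limI)
qed

end
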